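(* Let $(p_n)_{n \geqslant 0}$ be a real sequence with $p_0 > 0$ and $p_n \geqslant 0$ for all $n > 0$, and suppose that the Nörlund method $(N,p)$ is finite, i.e. $\sum_{n \geqslant 0} p_n < \infty$. Then $(N,p)$ is regular: every series that converges in the ordinary sense with sum $\sigma$ is $(N,p)$-summable with sum $\sigma$.
   Context: Let $(p_n)_{n\geqslant 0}$ be a real sequence with $p_0>0$ and $p_n\geqslant 0$ for $n>0$, and let $P_m = p_0+\cdots+p_m$. The Nörlund method $(N,p)$ associates to each sequence $s=(s_n)_{n\geqslant 0}$ of complex numbers the sequence $(t_m)_{m\geqslant 0}$ given by $$t_m = \frac{1}{P_m}\sum_{n=0}^m p_{m-n}s_n .$$ The sequence $s$ is $(N,p)$-convergent to $\sigma$ if $t_m\to\sigma$ in the ordinary sense as $m\to\infty$. A series $\sum_{n\geqslant 0} a_n$ is $(N,p)$-summable with sum $\sigma$ if its sequence of partial sums $s_n=a_0+\cdots+a_n$ is $(N,p)$-convergent to $\sigma$. The method $(N,p)$ is called finite if $\sum_{n\geqslant 0}p_n$ converges. A summation method is called regular if it assigns to each ordinarily convergent series its ordinary sum. *)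

theory Defs
  imports Complex_Main
begin

definition norlund_mean :: "(nat \<Rightarrow> real) \<Rightarrow> (nat \<Rightarrow> complex) \<Rightarrow> nat \<Rightarrow> complex" where
  "norlund_mean p s m =
     (1 / complex_of_real (\<Sum>k\<le>m. p k)) * (\<Sum>n\<le>m. complex_of_real (p (m - n)) * s n)"

definition norlund_convergent :: "(nat \<Rightarrow> real) \<Rightarrow> (nat \<Rightarrow> complex) \<Rightarrow> complex \<Rightarrow> bool" where
  "norlund_convergent p s \<sigma> \<longleftrightarrow> norlund_mean p s \<longlonglongrightarrow> \<sigma>"

definition norlund_sums :: "(nat \<Rightarrow> real) \<Rightarrow> (nat \<Rightarrow> complex) \<Rightarrow> complex \<Rightarrow> bool" where
  "norlund_sums p a \<sigma> \<longleftrightarrow> norlund_convergent p (\<lambda>n. \<Sum>k\<le>n. a k) \<sigma>"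

definition norlund_finite :: "(nat \<Rightarrow> real) \<Rightarrow> bool" where
  "norlund_finite p \<longleftrightarrow> summable p"

text \<open>A summation method is represented as the relation between (the terms of) a series and
  the values that the method assigns to it as a sum.\<close>

definition regular_method :: "((nat \<Rightarrow> complex) \<Rightarrow> complex \<Rightarrow> bool) \<Rightarrow> bool" where
  "regular_method M \<longleftrightarrow> (\<forall>a \<sigma>. a sums \<sigma> \<longrightarrow> M a \<sigma>)"

end

theory Submission
  imports Defs "HOL-Analysis.Uniform_Limit"
begin

text \<open>Written as \<open>(\<Sum>k\<le>m. p k * s (m - k)) / P\<^sub>m\<close>, the numerator of the mean is dominated
  termwise by a constant multiple of the summable sequence \<open>p\<close>, so by Tannery's theorem it tends
  to \<open>(\<Sum>k. p k) * \<sigma>\<close>. The denominator tends to \<open>\<Sum>k. p k\<close>, which is positive.\<close>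

lemma tendsto_convolution:
  fixes p s :: "nat \<Rightarrow> 'a :: {real_normed_algebra, banach}"
  assumes p: "summable (\<lambda>n. norm (p n))" and s: "s \<longlonglongrightarrow> \<sigma>"
  shows "(\<lambda>m. \<Sum>k\<le>m. p k * s (m - k)) \<longlonglongrightarrow> suminf p * \<sigma>"
proof -
  \<comment> \<open>Extending by zero past the diagonal turns sums of varying length into series
    over all \<open>k\<close>, the form Tannery's theorem requires.\<close>
  define a where "a k m = (if k \<le> m then p k * s (m - k) else 0)" for k m
  obtain B where B: "norm (s n) \<le> B" for n
    using convergent_imp_Bseq[OF convergentI[OF s]] by (auto simp: Bseq_def)
  \<comment> \<open>Covers the domination of \<open>a k m\<close> in the zero case
    \<open>k > m\<close>.\<close>
  have B0: "B \<ge> 0"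
    using B[of 0] norm_ge_zero order_trans by blast
  have lim: "(\<lambda>m. a k m) \<longlonglongrightarrow> p k * \<sigma>" for k
  \<comment> \<open>After a shift by \<open>k\<close> the case distinction disappears:
    \<open>a k (m + k) = p k * s m\<close>.\<close>
  proof (rule LIMSEQ_offset)
    show "(\<lambda>m. a k (m + k)) \<longlonglongrightarrow> p k * \<sigma>"
      using tendsto_mult_left[OF s] by (simp add: a_def)
  qed
  have "norm (a k m) \<le> norm (p k) * B" for k m
    using norm_mult_ineq[of "p k" "s (m - k)"] mult_left_mono[OF B norm_ge_zero] B0
    by (auto simp: a_def intro: order_trans)
  then have "\<forall>\<^sub>F (k, m) in at_top \<times>\<^sub>F sequentially. norm (a k m) \<le> norm (p k) * B"
    by (simp add: case_prod_unfold)
  from tannerys_theorem[OF lim this summable_mult2[OF p]]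
  have "(\<lambda>m. \<Sum>k. a k m) \<longlonglongrightarrow> (\<Sum>k. p k * \<sigma>)"
    by simp
  moreover have "(\<Sum>k. a k m) = (\<Sum>k\<le>m. p k * s (m - k))" for m
    by (subst suminf_finite[of "{..m}"]) (auto simp: a_def)
  moreover have "(\<Sum>k. p k * \<sigma>) = suminf p * \<sigma>"
    using suminf_mult2[OF summable_norm_cancel[OF p]] by simp
  ultimately show ?thesis
    by simp
qed

theorem theorem1:
  fixes p :: "nat \<Rightarrow> real"
  assumes "p 0 > 0"
    and "\<And>n. n > 0 \<Longrightarrow> p n \<ge> 0"
    and "norlund_finite p"
  shows "regular_method (norlund_sums p)"
  unfolding regular_method_def norlund_sums_def norlund_convergent_def
proof (intro allI impI)
  fix a :: "nat \<Rightarrow> complex" and \<sigma>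
  assume "a sums \<sigma>"
  define s where "s n = (\<Sum>k\<le>n. a k)" for n
  have s: "s \<longlonglongrightarrow> \<sigma>"
    \<comment> \<open>\<open>sums_def_le\<close> gives the partial sums that include the term of
      index \<open>n\<close>, as in \<open>s\<close>.\<close>
    using \<open>a sums \<sigma>\<close> by (simp add: sums_def_le s_def[abs_def])
  have nonneg: "p n \<ge> 0" for n
    using assms(1,2) by (cases n) (auto intro: less_imp_le)
  have p: "summable p"
    using assms(3) by (simp add: norlund_finite_def)
  have pos: "suminf p > 0"
    using p nonneg assms(1) by (intro suminf_pos2)
  \<comment> \<open>As \<open>p\<close> is nonnegative, its summability is already the absolute
    summability that \<open>tendsto_convolution\<close> asks for.\<close>
  have num: "(\<lambda>m. \<Sum>k\<le>m. complex_of_real (p k) * s (m - k)) \<longlonglongrightarrow> complex_of_real (suminf p) * \<sigma>"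
    using tendsto_convolution[of "\<lambda>n. complex_of_real (p n)", OF _ s] p nonneg
    by (simp add: suminf_of_real)
  have den: "(\<lambda>m. complex_of_real (\<Sum>k\<le>m. p k)) \<longlonglongrightarrow> complex_of_real (suminf p)"
    using summable_LIMSEQ'[OF p] by (rule tendsto_of_real)
  \<comment> \<open>The involution \<open>k \<mapsto> m - k\<close> of \<open>{..m}\<close> attaches
    each weight to a fixed index, so that single terms converge as \<open>m\<close> grows.\<close>
  have rev: "(\<Sum>n\<le>m. complex_of_real (p (m - n)) * s n)
      = (\<Sum>k\<le>m. complex_of_real (p k) * s (m - k))" for m
    by (rule sum.reindex_bij_witness[of _ "\<lambda>k. m - k" "\<lambda>k. m - k"]) auto
  have "norlund_mean p s
      = (\<lambda>m. (\<Sum>k\<le>m. complex_of_real (p k) * s (m - k)) / complex_of_real (\<Sum>k\<le>m. p k))"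
    by (simp add: fun_eq_iff norlund_mean_def rev)
  \<comment> \<open>By \<open>pos\<close> the limit of the denominators is nonzero, and the factor
    \<open>suminf p\<close> cancels.\<close>
  with tendsto_divide[OF num den] pos have "norlund_mean p s \<longlonglongrightarrow> \<sigma>"
    by simp
  then show "norlund_mean p (\<lambda>n. \<Sum>k\<le>n. a k) \<longlonglongrightarrow> \<sigma>"
    by (simp add: s_def[abs_def])
qed

end
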